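(* Let $r>0$ be an integer and let $s_n(m)$ denote the (polynomially extended) number of ballot paths to $(n,m)$ avoiding $r$ consecutive $\rightarrow$ steps, as described in the context. Then for every integer $m\ge 0$, as an identity of formal power series in $t$, $$\sum_{n\geq 0}s_{n}(m)\,t^{n}=\frac{(1-t^{r})^{m}}{(1-t)^{m+2}}\Bigl(r t^{r}(1-t)+(1-t^{r})(1-2t)\Bigr).$$
   Context: For $m\ge n\ge 0$, $s_n(m)$ is the number of lattice paths from $(0,0)$ to $(n,m)$ with unit steps $\uparrow=(0,1)$ and $\rightarrow=(1,0)$ that stay weakly above the diagonal $y=x$ and contain no $r$ consecutive $\rightarrow$ steps; also $s_n(n-1)=0$ for $n>0$. (Equivalently, for $m\ge n$, $s_n(m)$ is the number of paths with steps $(1,1)$ and $(1,-1)$ from $(0,0)$ to $(n+m,m-n)$ staying weakly above the $x$-axis and avoiding $r$ consecutive down steps.) These numbers are extended to all integers $m$ by: $s_n(m)=0$ for all $m$ if $n<0$; $s_0(m)=1$ for all $m\in\mathbb{Z}$; and for $n>0$ the values $s_n(m)$ with $m<n-1$ are defined by requiring $s_{n}(m)=s_{n-1}(m)+s_{n}(m-1)-s_{n-r}(m-1)$ for all $m\in\mathbb{Z}$. For each $n$ the function $m\mapsto s_n(m)$ is then a polynomial in $m$. For $n>m+1$ the coefficient $s_n(m)$ in the generating function is this extended value, not a path count. *)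

theory Defs
  imports "HOL-Library.Sublist" "HOL-Computational_Algebra.Formal_Power_Series"
begin

datatype step = Up | Right

text \<open>
  A lattice path starting at the origin is given by its word of steps; the points it visits are
  the pairs (number of \<open>Right\<close>s, number of \<open>Up\<close>s) of the prefixes of the word.
\<close>

definition ballot_paths :: "nat \<Rightarrow> nat \<Rightarrow> nat \<Rightarrow> step list set" where
  "ballot_paths r n m =
     {w. count_list w Right = n \<and> count_list w Up = m \<and>
         (\<forall>u. prefix u w \<longrightarrow> count_list u Right \<le> count_list u Up) \<and>
         \<not> sublist (replicate r Right) w}"

text \<open>
  The extended numbers \<open>s\<^sub>n(m)\<close>. The last branch is the recurrence
  \<open>s\<^sub>n(m) = s\<^sub>n\<^sub>-\<^sub>1(m) + s\<^sub>n(m - 1) - s\<^sub>n\<^sub>-\<^sub>r(m - 1)\<close> at \<open>m + 1\<close>, solved for its term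
  \<open>s\<^sub>n(m)\<close>, so that it determines the values for \<open>m < n - 1\<close>. (For \<open>m \<ge> n > 0\<close> the recurrence
  is a property of the path counts.) The value for \<open>r = 0\<close>, where the recurrence is
  circular, is irrelevant.
\<close>

function ballot_num :: "nat \<Rightarrow> int \<Rightarrow> int \<Rightarrow> int" where
  "ballot_num r n m =
     (if r = 0 \<or> n < 0 then 0
      else if n = 0 then 1
      else if m \<ge> n then int (card (ballot_paths r (nat n) (nat m)))
      else if m = n - 1 then 0
      else ballot_num r n (m + 1) - ballot_num r (n - 1) (m + 1) + ballot_num r (n - int r) m)"
  by pat_completeness auto
termination
  by (relation "measures [\<lambda>(r, n, m). nat n, \<lambda>(r, n, m). nat (n - m)]") auto

declare ballot_num.simps [simp del]

end

theory Submission imports Defs begin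

text \<open>
  Write \<open>A = 1 + t + \<dots> + t\<^sup>r\<^sup>-\<^sup>1 = (1 - t\<^sup>r) / (1 - t)\<close> and \<open>S\<^sub>m\<close> for the generating function
  \<open>\<Sum>\<^sub>n s\<^sub>n(m) t\<^sup>n\<close>. Cutting off the last step of a path shows that the recurrence holds for the
  path counts (\<open>card_ballot_paths_recurrence\<close>), hence for all extended values
  (\<open>ballot_num_recurrence\<close>); it says that \<open>S\<^sub>m\<^sub>+\<^sub>1 = A S\<^sub>m\<close>. Up to the choice of \<open>S\<^sub>0\<close> this
  determines everything, and \<open>S\<^sub>0\<close> is pinned down by the boundary values \<open>s\<^sub>0(m) = 1\<close> and
  \<open>s\<^sub>n(n - 1) = 0\<close>.

  The right-hand side of the theorem is \<open>A\<^sup>m (A - t A')\<close>. It has the boundary values because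
  \<open>n A\<^sup>n\<^sup>-\<^sup>1 (A - t A') = n A\<^sup>n - t (A\<^sup>n)'\<close>, and the operator \<open>t d/dt\<close> multiplies the coefficient
  of \<open>t\<^sup>n\<close> by \<open>n\<close> (\<open>fps_nth_power_diag\<close>). Induction on \<open>n\<close>, moving up and down in \<open>m\<close> from the
  diagonal \<open>m = n - 1\<close>, then identifies the two sides.
\<close>

section \<open>The recurrence for path counts\<close>

lemma count_list_replicate: "count_list (replicate n x) y = (if x = y then n else 0)"
  by (induction n) auto

lemma finite_ballot_paths: "finite (ballot_paths r n m)"
proof -
  have len: "length w = count_list w Up + count_list w Right" for w
  proof (induction w)
    case (Cons a w)
    then show ?case by (cases a) auto
  qed simp
  have "(UNIV :: step set) = {Up, Right}"
    using step.exhaust by auto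
  then have "finite (UNIV :: step set)"
    by (metis finite.emptyI finite.insertI)
  moreover have "ballot_paths r n m \<subseteq> {w. set w \<subseteq> UNIV \<and> length w = m + n}"
    unfolding ballot_paths_def by (auto simp: len)
  ultimately show ?thesis
    by (metis finite_lists_length_eq finite_subset)
qed

lemma ballot_paths_eq_empty:
  assumes "m < n"
  shows "ballot_paths r n m = {}"
  using assms unfolding ballot_paths_def by (auto simp: not_le[symmetric])

lemma ballot_paths_prefix_closed:
  assumes "u @ v \<in> ballot_paths r n m"
  shows "u \<in> ballot_paths r (count_list u Right) (count_list u Up)"
  using assms unfolding ballot_paths_def by (auto simp: sublist_append)

lemma snoc_Up_in_ballot_paths_iff:
  assumes "r > 0"
  shows "w @ [Up] \<in> ballot_paths r n (Suc m) \<longleftrightarrow> w \<in> ballot_paths r n m"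
proof -
  have "\<not> suffix (replicate r Right) (w @ [Up])"
  proof
    assume "suffix (replicate r Right) (w @ [Up])"
    then obtain zs where "replicate r Right = zs @ [Up]"
      using assms by auto
    then have "Up \<in> set (replicate r Right)" by simp
    then show False by auto
  qed
  then show ?thesis
    unfolding ballot_paths_def by (auto simp: sublist_snoc intro: le_SucI)
qed

lemma snoc_Right_in_ballot_paths_iff:
  "w @ [Right] \<in> ballot_paths (Suc k) (Suc n) m \<longleftrightarrow>
     w \<in> ballot_paths (Suc k) n m \<and> n < m \<and> \<not> suffix (replicate k Right) w"
proof -
  have "suffix (replicate (Suc k) Right) (w @ [Right]) \<longleftrightarrow> suffix (replicate k Right) w"
    by (simp add: replicate_append_same[symmetric] del: suffix_snoc)
  then show ?thesis
    unfolding ballot_paths_def by (auto simp: sublist_snoc Suc_le_eq simp del: replicate.simps)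
qed

lemma append_Rights_in_ballot_paths:
  assumes "v \<in> ballot_paths r n m" "j < r" "n + j \<le> Suc m"
  shows "v @ Up # replicate j Right \<in> ballot_paths r (n + j) (Suc m)"
  using assms(2,3)
proof (induction j)
  case 0
  then show ?case using assms(1) snoc_Up_in_ballot_paths_iff by simp
next
  case (Suc j)
  obtain k where r: "r = Suc k" using Suc.prems by (cases r) auto
  have "\<not> suffix (replicate k Right) (v @ Up # replicate j Right)"
  proof
    assume *: "suffix (replicate k Right) (v @ Up # replicate j Right)"
    have "suffix (Up # replicate j Right) (v @ Up # replicate j Right)"
      by (rule suffixI) simp
    then have "suffix (Up # replicate j Right) (replicate k Right)"
      by (rule suffix_length_suffix[OF _ *]) (use Suc.prems r in simp)
    then show False by (auto dest!: set_mono_suffix)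
  qed
  then have "(v @ Up # replicate j Right) @ [Right] \<in> ballot_paths r (Suc (n + j)) (Suc m)"
    using Suc unfolding r snoc_Right_in_ballot_paths_iff by simp
  then show ?case by (simp add: replicate_append_same)
qed

text \<open>
  The paths that cannot be prolonged by a \<open>Right\<close> step, because they end in \<open>r - 1\<close> of them:
  these \<open>Right\<close> steps must be preceded by an \<open>Up\<close> step.
\<close>

lemma ballot_paths_suffix_Rights:
  assumes "n \<le> m"
  shows "{w \<in> ballot_paths (Suc k) n (Suc m). suffix (replicate k Right) w} =
    (if k \<le> n then (\<lambda>v. v @ Up # replicate k Right) ` ballot_paths (Suc k) (n - k) m else {})"
    (is "?B = ?I")
proof (intro equalityI subsetI)
  fix w assume "w \<in> ?B"
  then obtain u where w: "w = u @ replicate k Right" "w \<in> ballot_paths (Suc k) n (Suc m)"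
    by (auto elim: suffixE)
  have count: "count_list u Right + k = n" "count_list u Up = Suc m"
    using w unfolding ballot_paths_def by (auto simp: count_list_replicate)
  obtain v x where u: "u = v @ [x]"
    using count(2) by (cases u rule: rev_cases) auto
  have "x \<noteq> Right"
  proof
    assume "x = Right"
    then have "w = v @ replicate (Suc k) Right" using w u by simp
    then show False using w(2) unfolding ballot_paths_def by auto
  qed
  then have x: "x = Up" by (cases x) auto
  have "v \<in> ballot_paths (Suc k) (count_list v Right) (count_list v Up)"
    using ballot_paths_prefix_closed w u by (metis append.assoc)
  then have "v \<in> ballot_paths (Suc k) (n - k) m"
    using count u x by auto
  then show "w \<in> ?I" using count w(1) u x by auto
next
  fix w assume "w \<in> ?I"
  then obtain v where v: "k \<le> n" "w = v @ Up # replicate k Right"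
      "v \<in> ballot_paths (Suc k) (n - k) m"
    by (auto split: if_splits)
  have "w \<in> ballot_paths (Suc k) n (Suc m)"
    using append_Rights_in_ballot_paths[OF v(3), of k] v assms by simp
  moreover have "suffix (replicate k Right) w"
    unfolding v(2) by (rule suffixI[of _ "v @ [Up]"]) simp
  ultimately show "w \<in> ?B" by simp
qed

lemma card_ballot_paths_recurrence:
  assumes "n \<le> m"
  shows "card (ballot_paths (Suc k) (Suc n) (Suc m)) +
      (if k \<le> n then card (ballot_paths (Suc k) (n - k) m) else 0) =
    card (ballot_paths (Suc k) n (Suc m)) + card (ballot_paths (Suc k) (Suc n) m)"
proof -
  let ?P = "ballot_paths (Suc k)"
  let ?bad = "{w \<in> ?P n (Suc m). suffix (replicate k Right) w}"
  let ?good = "{w \<in> ?P n (Suc m). \<not> suffix (replicate k Right) w}"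
  have "?P (Suc n) (Suc m) = (\<lambda>w. w @ [Up]) ` ?P (Suc n) m \<union> (\<lambda>w. w @ [Right]) ` ?good"
    (is "_ = ?U \<union> ?R")
  proof (intro equalityI subsetI)
    fix w assume w: "w \<in> ?P (Suc n) (Suc m)"
    then obtain v x where v: "w = v @ [x]"
      unfolding ballot_paths_def by (cases w rule: rev_cases) auto
    show "w \<in> ?U \<union> ?R"
      using w unfolding v
      by (cases x) (auto simp: snoc_Up_in_ballot_paths_iff snoc_Right_in_ballot_paths_iff)
  next
    fix w assume "w \<in> ?U \<union> ?R"
    then show "w \<in> ?P (Suc n) (Suc m)"
      using assms by (auto simp: snoc_Up_in_ballot_paths_iff snoc_Right_in_ballot_paths_iff)
  qed
  moreover have "card (?U \<union> ?R) = card ?U + card ?R"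
    by (rule card_Un_disjoint) (auto simp: finite_ballot_paths)
  moreover have "card ?U = card (?P (Suc n) m)" "card ?R = card ?good"
    by (simp_all add: card_image inj_on_def)
  moreover have "card (?P n (Suc m)) = card ?bad + card ?good"
  proof -
    have "?P n (Suc m) = ?bad \<union> ?good" by auto
    moreover have "card (?bad \<union> ?good) = card ?bad + card ?good"
      by (rule card_Un_disjoint) (auto simp: finite_ballot_paths)
    ultimately show ?thesis by simp
  qed
  moreover have "card ?bad = (if k \<le> n then card (?P (n - k) m) else 0)"
    unfolding ballot_paths_suffix_Rights[OF assms] by (simp add: card_image inj_on_def)
  ultimately show ?thesis by simp
qed

lemma card_ballot_paths_0: "card (ballot_paths (Suc k) 0 m) = 1"
proof -
  have "ballot_paths (Suc k) 0 m = {replicate m Up}"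
  proof (intro equalityI subsetI)
    fix w assume w: "w \<in> ballot_paths (Suc k) 0 m"
    then have "Right \<notin> set w"
      unfolding ballot_paths_def by (auto simp: count_list_0_iff)
    then have "\<forall>x\<in>set w. x = Up"
      by (metis step.exhaust)
    then have "replicate (length w) Up = w"
      by (rule replicate_length_same)
    moreover from this have "count_list w Up = length w"
      by (metis count_list_replicate)
    ultimately show "w \<in> {replicate m Up}"
      using w unfolding ballot_paths_def by auto
  next
    fix w assume "w \<in> {replicate m Up}"
    then show "w \<in> ballot_paths (Suc k) 0 m"
      unfolding ballot_paths_def
      by (auto dest!: set_mono_sublist set_mono_prefix
          simp: count_list_replicate intro!: eq_refl[OF count_notin, THEN order.trans])
  qed
  then show ?thesis by simp
qed

section \<open>The recurrence for the extended numbers\<close>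

lemma ballot_num_0:
  assumes "r > 0"
  shows "ballot_num r 0 m = 1"
  using assms by (subst ballot_num.simps) simp

lemma ballot_num_eq_0_diag:
  assumes "n > 0"
  shows "ballot_num r n (n - 1) = 0"
  using assms by (subst ballot_num.simps) simp

text \<open>The path count is also right on the line \<open>m = n - 1\<close>, where there are no ballot paths.\<close>

lemma ballot_num_eq_card:
  assumes "n \<le> Suc m"
  shows "ballot_num (Suc k) (int n) (int m) = int (card (ballot_paths (Suc k) n m))"
proof (cases "n = 0")
  case True
  then show ?thesis by (simp add: ballot_num_0 card_ballot_paths_0)
next
  case False
  then show ?thesis
    using assms by (subst ballot_num.simps) (auto simp: ballot_paths_eq_empty)
qed

lemma ballot_num_recurrence:
  "ballot_num (Suc k) (int (Suc n)) (int (Suc m)) - ballot_num (Suc k) (int (Suc n)) (int m) =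
   ballot_num (Suc k) (int n) (int (Suc m)) -
     (if k \<le> n then ballot_num (Suc k) (int (n - k)) (int m) else 0)"
proof (cases "n \<le> m")
  case True
  then show ?thesis
    using card_ballot_paths_recurrence[OF True, of k]
    by (simp add: ballot_num_eq_card del: of_nat_Suc of_nat_diff split: if_splits)
next
  case False
  \<comment> \<open>Below the diagonal the recurrence is the definition; the subtracted term vanishes for
    negative index.\<close>
  have "ballot_num (Suc k) (int (Suc n)) (int m) =
      ballot_num (Suc k) (int (Suc n)) (int m + 1) - ballot_num (Suc k) (int (Suc n) - 1) (int m + 1)
      + ballot_num (Suc k) (int (Suc n) - int (Suc k)) (int m)"
    using False by (subst ballot_num.simps) simp
  moreover have "ballot_num (Suc k) (int (Suc n) - int (Suc k)) (int m) =
      (if k \<le> n then ballot_num (Suc k) (int (n - k)) (int m) else 0)"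
  proof (cases "k \<le> n")
    case True
    then show ?thesis by (simp add: of_nat_diff)
  next
    case False
    then show ?thesis by (subst ballot_num.simps) simp
  qed
  ultimately show ?thesis by (simp add: add.commute)
qed

section \<open>The generating function\<close>

lemma fps_nth_power_diag:
  fixes A :: "'a :: field_char_0 fps"
  shows "fps_nth (A ^ n * (A - fps_X * fps_deriv A)) (Suc n) = 0"
proof -
  have "of_nat (Suc n) * (A ^ n * (A - fps_X * fps_deriv A)) =
      of_nat (Suc n) * A ^ Suc n - fps_X * fps_deriv (A ^ Suc n)"
    by (subst fps_deriv_power') (simp add: algebra_simps del: of_nat_Suc)
  then have "of_nat (Suc n) * fps_nth (A ^ n * (A - fps_X * fps_deriv A)) (Suc n) =
      fps_nth (of_nat (Suc n) * A ^ Suc n - fps_X * fps_deriv (A ^ Suc n)) (Suc n)"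
    by (metis fps_mult_of_nat_nth(1))
  also have "\<dots> = 0"
    unfolding fps_sub_nth fps_mult_of_nat_nth by (simp del: power_Suc of_nat_Suc)
  finally show ?thesis by (simp del: of_nat_Suc)
qed

lemma ballot_num_eq_fps_nth:
  fixes A :: "'a :: field_char_0 fps"
  assumes A: "(1 - fps_X) * A = 1 - fps_X ^ Suc k"
  shows "of_int (ballot_num (Suc k) (int n) (int m)) =
    fps_nth (A ^ m * (A - fps_X * fps_deriv A)) n"
proof (induction n arbitrary: m rule: less_induct)
  case (less n)
  define F where "F m = A ^ m * (A - fps_X * fps_deriv A)" for m
  define s :: "nat \<Rightarrow> nat \<Rightarrow> 'a" where "s n m = of_int (ballot_num (Suc k) (int n) (int m))" for n m
  have "s n m = fps_nth (F m) n"
  proof (cases n)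
    case 0
    have "fps_nth ((1 - fps_X) * A) 0 = 1"
      unfolding A by simp
    then have "fps_nth A 0 = 1" by simp
    then show ?thesis
      using 0 by (simp add: s_def F_def ballot_num_0 fps_nth_power_0)
  next
    case (Suc p)
    have IH: "s q j = fps_nth (F j) q" if "q \<le> p" for q j
      using less.IH[of q j] that Suc unfolding s_def F_def by simp
    have s_step: "s (Suc p) (Suc j) - s (Suc p) j = s p (Suc j) - (if k \<le> p then s (p - k) j else 0)"
      for j
      using arg_cong[OF ballot_num_recurrence[of k p j], of "of_int :: int \<Rightarrow> 'a"]
      unfolding s_def by (simp split: if_splits)
    have F_step: "fps_nth (F (Suc j)) (Suc p) - fps_nth (F j) (Suc p) =
        fps_nth (F (Suc j)) p - (if k \<le> p then fps_nth (F j) (p - k) else 0)" for j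
    proof -
      have "(1 - fps_X) * F (Suc j) = ((1 - fps_X) * A) * F j"
        by (simp add: F_def algebra_simps)
      also have "\<dots> = (1 - fps_X ^ Suc k) * F j"
        unfolding A ..
      finally have "F (Suc j) - fps_X * F (Suc j) = F j - fps_X ^ Suc k * F j"
        by (simp add: left_diff_distrib)
      from arg_cong[OF this, of "\<lambda>f. fps_nth f (Suc p)"]
      have "fps_nth (F (Suc j)) (Suc p) - fps_nth (F (Suc j)) p =
          fps_nth (F j) (Suc p) - (if k \<le> p then fps_nth (F j) (p - k) else 0)"
        by (simp add: fps_X_power_mult_nth not_less del: power_Suc split: if_splits)
      then show ?thesis by (simp add: algebra_simps)
    qed
    have step: "s (Suc p) (Suc j) = fps_nth (F (Suc j)) (Suc p) \<longleftrightarrow> s (Suc p) j = fps_nth (F j) (Suc p)"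
      for j
    proof -
      have "s (Suc p) (Suc j) - s (Suc p) j = fps_nth (F (Suc j)) (Suc p) - fps_nth (F j) (Suc p)"
        unfolding s_step F_step by (simp add: IH)
      then show ?thesis by (auto simp: algebra_simps)
    qed
    have diag: "s (Suc p) p = fps_nth (F p) (Suc p)"
      using ballot_num_eq_0_diag[of "int (Suc p)" "Suc k"] fps_nth_power_diag[of A p]
      unfolding s_def F_def by simp
    have "s (Suc p) m = fps_nth (F m) (Suc p)"
    proof (cases "p \<le> m")
      case True
      then show ?thesis by (induction m rule: dec_induct) (use diag step in auto)
    next
      case False
      then have "m \<le> p" by simp
      then show ?thesis by (induction m rule: inc_induct) (use diag step in auto)
    qed
    then show ?thesis using Suc by simp
  qed
  then show ?case unfolding s_def F_def .
qed

theorem mainTheorem3: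
  fixes r m :: nat
  assumes "r > 0"
  shows "Abs_fps (\<lambda>n. of_int (ballot_num r (int n) (int m))) =
    (1 - fps_X ^ r) ^ m / (1 - fps_X) ^ (m + 2) *
      (of_nat r * fps_X ^ r * (1 - fps_X) + (1 - fps_X ^ r) * (1 - 2 * fps_X) :: rat fps)"
proof -
  obtain k where r: "r = Suc k" using assms by (cases r) auto
  let ?D = "1 - fps_X :: rat fps"
  define A :: "rat fps" where "A = (\<Sum>i<r. fps_X ^ i)"
  have A: "?D * A = 1 - fps_X ^ r"
    unfolding A_def by (rule one_diff_power_eq[symmetric])
  \<comment> \<open>Differentiating \<open>(1 - t) A = 1 - t\<^sup>r\<close> and multiplying by \<open>t\<close>.\<close>
  have "fps_X * fps_deriv (?D * A) = fps_X * fps_deriv (1 - fps_X ^ r)"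
    unfolding A ..
  then have deriv: "?D * (fps_X * fps_deriv A) = fps_X * A - of_nat r * fps_X ^ r"
    by (simp add: r fps_deriv_power' algebra_simps del: of_nat_Suc power_Suc)
      (simp add: algebra_simps del: of_nat_Suc)
  have "?D ^ 2 * (A - fps_X * fps_deriv A) =
      ?D * (?D * A) - ?D * (?D * (fps_X * fps_deriv A))"
    by (simp add: power2_eq_square algebra_simps)
  also have "\<dots> = ?D * (?D * A) - fps_X * (?D * A) + of_nat r * fps_X ^ r * ?D"
    unfolding deriv by (simp add: algebra_simps)
  also have "\<dots> = of_nat r * fps_X ^ r * ?D + (1 - fps_X ^ r) * (1 - 2 * fps_X)"
    unfolding A by (simp add: algebra_simps)
  finally have num: "of_nat r * fps_X ^ r * ?D + (1 - fps_X ^ r) * (1 - 2 * fps_X) =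
      ?D ^ 2 * (A - fps_X * fps_deriv A)" ..
  have "(1 - fps_X ^ r) ^ m / ?D ^ (m + 2) * (?D ^ 2 * (A - fps_X * fps_deriv A)) =
      A ^ m * (A - fps_X * fps_deriv A)"
  proof -
    have inv: "inverse (?D ^ (m + 2)) * ?D ^ (m + 2) = 1"
      by (rule inverse_mult_eq_1) (simp add: fps_nth_power_0)
    have "(1 - fps_X ^ r) ^ m / ?D ^ (m + 2) * (?D ^ 2 * (A - fps_X * fps_deriv A)) =
        (?D * A) ^ m * inverse (?D ^ (m + 2)) * (?D ^ 2 * (A - fps_X * fps_deriv A))"
      unfolding A by (subst fps_divide_unit) (simp_all add: fps_nth_power_0)
    also have "\<dots> = (inverse (?D ^ (m + 2)) * ?D ^ (m + 2)) * (A ^ m * (A - fps_X * fps_deriv A))"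
      by (simp only: power_mult_distrib power_add mult_ac)
    finally show ?thesis unfolding inv by simp
  qed
  moreover have "Abs_fps (\<lambda>n. of_int (ballot_num r (int n) (int m))) =
      A ^ m * (A - fps_X * fps_deriv A)"
    using ballot_num_eq_fps_nth[of A k _ m] A unfolding r by (intro fps_ext) simp
  ultimately show ?thesis unfolding num by (simp only:)
qed

end
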